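(* Let $\mu,\lambda\in\mathbb{R}$ with $\lambda\neq0$ and $\rho=\mu/\lambda>0$. Let $\tilde\sigma\in\mathbb{C}$, $\sigma=\tilde\sigma/\lambda$, let $\varphi\in\mathbb{B}$ with $\varphi(0)=0$ satisfy $H_{\mu,\lambda}\varphi=\tilde\sigma\varphi$, put $\varphi_0(y)=\varphi(iy)$ and define, for $y<0$, $$\psi(y)=\frac{\varphi_0'(y)}{y}\,e^{-\frac{y^2}{2}}\,\theta(y).$$ Then $\psi\in L^2((-\infty,0],|\theta(y)|\,dy)$ and $\psi$ satisfies the integral equation $$\psi(y)=-\sigma\,e^{\frac{\rho^2}{2}}\int_{-\infty}^{0}\mathcal{N}(y,s)\,\psi(s)\,ds,\qquad y<0 .$$
   Context: The Bargmann space is $\mathbb{B}=\{\varphi:\mathbb{C}\to\mathbb{C}\text{ entire};\ \int_{\mathbb{C}}|\varphi(z)|^2e^{-|z|^2}\,dx\,dy<\infty\}$. For real $\mu,\lambda$, $H_{\mu,\lambda}=\mu z\frac{d}{dz}+i\lambda\big(z\frac{d^2}{dz^2}+z^2\frac{d}{dz}\big)$. The function $\theta$ on $(-\infty,0]$ is $\theta(y)=y$ for $y\in[-1,0]$ and $\theta(y)=-1$ for $y<-1$. For $\rho>0$ and $y,s<0$ the kernel is $$\mathcal{N}(y,s)=e^{-\rho y}\,\frac{\theta(y)}{y}\,\frac{s}{\theta(s)}\,e^{\frac{s^2}{2}}\int_{-\infty}^{\min(y,s)}\frac{e^{-\frac12(u-\rho)^2}}{u}\,du .$$ *)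

theory Defs
  imports "HOL-Analysis.Analysis"
begin

definition bargmann :: "(complex \<Rightarrow> complex) \<Rightarrow> bool" where
  "bargmann \<phi> \<longleftrightarrow> \<phi> holomorphic_on UNIV \<and>
     (\<lambda>z. (cmod (\<phi> z))^2 * exp (- ((cmod z)^2))) integrable_on (UNIV :: complex set)"

definition H_op :: "real \<Rightarrow> real \<Rightarrow> (complex \<Rightarrow> complex) \<Rightarrow> complex \<Rightarrow> complex" where
  "H_op \<mu> lam \<phi> z = of_real \<mu> * z * deriv \<phi> z
     + \<i> * of_real lam * (z * (deriv ^^ 2) \<phi> z + z^2 * deriv \<phi> z)"

definition theta :: "real \<Rightarrow> real" where
  "theta y = (if y \<ge> -1 then y else -1)"

definition kernelN :: "real \<Rightarrow> real \<Rightarrow> real \<Rightarrow> real" where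
  "kernelN \<rho> y s = exp (- \<rho> * y) * (theta y / y) * (s / theta s) * exp (s^2 / 2)
     * integral {..min y s} (\<lambda>u. exp (- ((u - \<rho>)^2) / 2) / u)"

end

theory Submission
  imports Defs "HOL-Complex_Analysis.Cauchy_Integral_Formula"
begin

text \<open>On the imaginary axis the eigenvalue equation becomes \<open>y f'' + (\<rho> y - y\<^sup>2) f' = \<sigma> f\<close> for
  \<open>f y = \<phi> (\<i> y)\<close>, that is \<open>(exp (\<rho> y - y\<^sup>2 / 2) f')' = \<sigma> exp (\<rho> y - y\<^sup>2 / 2) f / y\<close>, and in terms of
  \<open>f'\<close> the integral equation is the integrated form of this identity, with the double integral
  resolved by integration by parts. The boundary terms at \<open>-\<infinity>\<close> vanish because \<open>f\<close> and \<open>f'\<close> are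
  \<open>O((1 + |y|) exp (y\<^sup>2 / 2))\<close> while \<open>\<rho> > 0\<close>. This growth bound, and the square integrability
  of \<open>\<psi>\<close>, come from the area mean value property applied to \<open>\<phi>\<close> times a suitable exponential.\<close>

subsection \<open>The area mean value property\<close>

lemma borel_measurable_Complex [measurable]:
  assumes [measurable]: "f \<in> borel_measurable M" "g \<in> borel_measurable M"
  shows "(\<lambda>x. Complex (f x) (g x)) \<in> borel_measurable M"
  unfolding Complex_eq by measurable

text \<open>\<open>lborel\<close> is determined by its values on boxes, and a complex box is the
  product of its real and imaginary sides. This makes Tonelli available for integrals over the
  plane.\<close>

lemma lborel_complex_conv_prod:
  "(lborel :: complex measure) = distr (lborel \<Otimes>\<^sub>M lborel) borel (\<lambda>(x, y). Complex x y)"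
proof (rule lborel_eqI)
  fix l u :: complex
  assume "\<And>b. b \<in> Basis \<Longrightarrow> l \<bullet> b \<le> u \<bullet> b"
  from this[of 1] this[of \<i>] have le: "Re l \<le> Re u" "Im l \<le> Im u"
    by (simp_all add: Basis_complex_def)
  have "(\<lambda>(x, y). Complex x y) -` box l u \<inter> space (lborel \<Otimes>\<^sub>M lborel)
      = {Re l<..<Re u} \<times> {Im l<..<Im u}"
    by (auto simp: box_def Basis_complex_def space_pair_measure)
  moreover have "(\<lambda>(x, y). Complex x y) \<in> borel_measurable (lborel \<Otimes>\<^sub>M lborel)"
    by measurable
  ultimately show "emeasure (distr (lborel \<Otimes>\<^sub>M lborel) borel (\<lambda>(x, y). Complex x y)) (box l u)
      = (\<Prod>b\<in>Basis. (u - l) \<bullet> b)"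
    using le by (simp add: emeasure_distr lborel.emeasure_pair_measure_Times Basis_complex_def ennreal_mult
        complex_eq_iff)
qed simp

lemma
  fixes f :: "complex \<Rightarrow> ennreal"
  assumes [measurable]: "f \<in> borel_measurable borel"
  shows nn_integral_complex_Re_Im: "(\<integral>\<^sup>+w. f w \<partial>lborel) = (\<integral>\<^sup>+x. (\<integral>\<^sup>+y. f (Complex x y) \<partial>lborel) \<partial>lborel)"
    and nn_integral_complex_Im_Re: "(\<integral>\<^sup>+w. f w \<partial>lborel) = (\<integral>\<^sup>+y. (\<integral>\<^sup>+x. f (Complex x y) \<partial>lborel) \<partial>lborel)"
proof -
  have [measurable]: "(\<lambda>(x, y). Complex x y) \<in> borel_measurable (lborel \<Otimes>\<^sub>M lborel)"
    by measurable
  have eq: "(\<integral>\<^sup>+w. f w \<partial>lborel) = (\<integral>\<^sup>+(x, y). f (Complex x y) \<partial>(lborel \<Otimes>\<^sub>M lborel))"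
    by (subst lborel_complex_conv_prod) (simp add: nn_integral_distr case_prod_unfold)
  have m: "(\<lambda>(x, y). f (Complex x y)) \<in> borel_measurable (lborel \<Otimes>\<^sub>M lborel)"
    by measurable
  show "(\<integral>\<^sup>+w. f w \<partial>lborel) = (\<integral>\<^sup>+x. (\<integral>\<^sup>+y. f (Complex x y) \<partial>lborel) \<partial>lborel)"
    using lborel.nn_integral_fst[OF m] eq by simp
  show "(\<integral>\<^sup>+w. f w \<partial>lborel) = (\<integral>\<^sup>+y. (\<integral>\<^sup>+x. f (Complex x y) \<partial>lborel) \<partial>lborel)"
    using lborel_pair.nn_integral_snd[OF m] eq by simp
qed

lemma nn_integral_real_translate:
  fixes f :: "real \<Rightarrow> ennreal"
  assumes "f \<in> borel_measurable borel"
  shows "(\<integral>\<^sup>+x. f (x + c) \<partial>lborel) = (\<integral>\<^sup>+x. f x \<partial>lborel)"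
  using nn_integral_real_affine[OF assms, of 1 c] by (simp add: add.commute)

text \<open>A shear translates one coordinate by an amount fixed by the other, so integrating the
  sheared coordinate first removes it by translation invariance.\<close>

lemma
  fixes f :: "complex \<Rightarrow> ennreal"
  assumes [measurable]: "f \<in> borel_measurable borel"
  shows nn_integral_shear_Re: "(\<integral>\<^sup>+w. f (Complex (Re w + a * Im w) (Im w)) \<partial>lborel) = (\<integral>\<^sup>+w. f w \<partial>lborel)"
    and nn_integral_shear_Im: "(\<integral>\<^sup>+w. f (Complex (Re w) (Im w + a * Re w)) \<partial>lborel) = (\<integral>\<^sup>+w. f w \<partial>lborel)"
proof -
  have [measurable]: "(\<lambda>x. f (Complex x y)) \<in> borel_measurable borel"
    "(\<lambda>y. f (Complex x y)) \<in> borel_measurable borel"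
    "(\<lambda>w. f (Complex (Re w + a * Im w) (Im w))) \<in> borel_measurable borel"
    "(\<lambda>w. f (Complex (Re w) (Im w + a * Re w))) \<in> borel_measurable borel" for x y
    by measurable
  show "(\<integral>\<^sup>+w. f (Complex (Re w + a * Im w) (Im w)) \<partial>lborel) = (\<integral>\<^sup>+w. f w \<partial>lborel)"
    by (simp add: nn_integral_complex_Im_Re
        nn_integral_real_translate[of "\<lambda>x. f (Complex x _)"])
  show "(\<integral>\<^sup>+w. f (Complex (Re w) (Im w + a * Re w)) \<partial>lborel) = (\<integral>\<^sup>+w. f w \<partial>lborel)"
    by (simp add: nn_integral_complex_Re_Im
        nn_integral_real_translate[of "\<lambda>y. f (Complex _ y)"])
qed

text \<open>Reduces the rotation invariance of \<open>lborel\<close> on the plane to Tonelli and translation invariance.\<close>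

lemma cis_mult_conv_shears:
  assumes "cos (t / 2) \<noteq> 0"
  defines "a \<equiv> - tan (t / 2)"
  shows "cis t * w = (let u = Complex (Re w + a * Im w) (Im w);
                          v = Complex (Re u) (Im u + sin t * Re u)
                      in Complex (Re v + a * Im v) (Im v))"
proof -
  have s: "sin t = 2 * sin (t/2) * cos (t/2)" and c: "cos t = 1 - 2 * (sin (t/2))^2"
    and c': "cos t = 2 * (cos (t/2))^2 - 1"
    using sin_double[of "t/2"] cos_double_sin[of "t/2"] cos_double_cos[of "t/2"] by simp_all
  have 1: "1 + a * sin t = cos t"
    using assms(1) by (simp add: a_def s c tan_def power2_eq_square)
  have "- a * (1 + cos t) = sin t"
    using assms(1) by (simp add: a_def s c' tan_def power2_eq_square)
  then have 2: "a + a * cos t = - sin t"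
    by (simp add: algebra_simps)
  have "Re (cis t * w) = (1 + a * sin t) * Re w + (a + a * (1 + a * sin t)) * Im w"
    unfolding 1 2 by simp
  moreover have "Im (cis t * w) = sin t * Re w + (1 + a * sin t) * Im w"
    unfolding 1 by simp
  ultimately show ?thesis
    unfolding complex_eq_iff Let_def by (simp add: algebra_simps)
qed

text \<open>The rotation is a composition of three shears, each preserving the measure. Half-turns
  are excluded because \<open>tan (t / 2)\<close> is singular there; only angles up to
  \<open>pi / 2\<close> occur below.\<close>

lemma distr_lborel_cis_mult:
  assumes "cos (t / 2) \<noteq> 0"
  shows "distr lborel borel (\<lambda>w. cis t * w) = lborel"
proof (rule measure_eqI)
  fix A assume "A \<in> sets (distr lborel borel (\<lambda>w. cis t * w))"
  then have [measurable]: "A \<in> sets borel" by simp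
  define f where "f = (indicator A :: complex \<Rightarrow> ennreal)"
  define a where "a = - tan (t / 2)"
  have [measurable]: "f \<in> borel_measurable borel" unfolding f_def by simp
  define h where "h = (\<lambda>v. f (Complex (Re v + a * Im v) (Im v)))"
  define k where "k = (\<lambda>u. h (Complex (Re u) (Im u + sin t * Re u)))"
  have [measurable]: "h \<in> borel_measurable borel"
    unfolding h_def by measurable
  have [measurable]: "k \<in> borel_measurable borel"
    unfolding k_def by measurable
  have "emeasure (distr lborel borel (\<lambda>w. cis t * w)) A = (\<integral>\<^sup>+w. f (cis t * w) \<partial>lborel)"
    unfolding f_def by (simp flip: nn_integral_indicator add: nn_integral_distr)
  also have "\<dots> = (\<integral>\<^sup>+w. k (Complex (Re w + a * Im w) (Im w)) \<partial>lborel)"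
    unfolding cis_mult_conv_shears[OF assms] k_def h_def a_def Let_def by simp
  also have "\<dots> = (\<integral>\<^sup>+w. h w \<partial>lborel)"
    by (subst nn_integral_shear_Re, simp) (unfold k_def, simp add: nn_integral_shear_Im)
  also have "\<dots> = (\<integral>\<^sup>+w. f w \<partial>lborel)"
    by (simp add: h_def nn_integral_shear_Re)
  finally show "emeasure (distr lborel borel (\<lambda>w. cis t * w)) A = emeasure lborel A"
    by (simp add: f_def)
qed simp

text \<open>A rotation preserves the disc and the measure but multiplies \<open>w ^ n\<close> by
  \<open>cis (n * t)\<close>; a factor other than 1 forces the integral to vanish.\<close>

lemma integral_cball_power_eq_0:
  fixes n :: nat
  assumes "n > 0"
  shows "(\<integral>w. indicator (cball 0 r) w *\<^sub>R w ^ n \<partial>lborel) = (0 :: complex)"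
proof -
  \<comment> \<open>The choice \<open>n * t = pi / 2\<close> makes the factor \<open>\<i>\<close>.
    The simpler \<open>pi / n\<close> would be the excluded half-turn when
    \<open>n = 1\<close>.\<close>
  define t where "t = pi / (2 * real n)"
  have t: "0 < t" "t \<le> pi / 2" using assms by (auto simp: t_def field_simps)
  have "cos (t / 2) > 0" using t by (intro cos_gt_zero_pi) auto
  define I where "I = (\<integral>w. indicator (cball 0 r) w *\<^sub>R w ^ n \<partial>(lborel :: complex measure))"
  have "I = (\<integral>w. indicator (cball 0 r) w *\<^sub>R w ^ n \<partial>distr lborel borel (\<lambda>w. cis t * w))"
    using \<open>cos (t / 2) > 0\<close> by (simp add: I_def distr_lborel_cis_mult)
  also have "\<dots> = (\<integral>w. indicator (cball 0 r) (cis t * w) *\<^sub>R (cis t * w) ^ n \<partial>lborel)"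
  proof (rule integral_distr)
    have "(\<lambda>w. w ^ n) \<in> borel_measurable (borel :: complex measure)"
      by (intro borel_measurable_continuous_onI continuous_intros)
    then show "(\<lambda>w. indicat_real (cball 0 r) w *\<^sub>R w ^ n) \<in> borel_measurable (borel :: complex measure)"
      by (intro borel_measurable_scaleR borel_measurable_indicator) auto
  qed simp
  also have "\<dots> = (\<integral>w. cis t ^ n * (indicator (cball 0 r) w *\<^sub>R w ^ n) \<partial>lborel)"
    by (intro Bochner_Integration.integral_cong)
       (auto simp: indicator_def norm_mult power_mult_distrib)
  also have "\<dots> = cis t ^ n * I" unfolding I_def by (rule integral_mult_right_zero)
  also have "cis t ^ n = \<i>"
  proof -
    have "real n * t = pi / 2" using assms by (simp add: t_def)
    then show ?thesis by (metis Complex.DeMoivre cis_pi_half)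
  qed
  finally have "(1 - \<i>) * I = 0" by (simp add: algebra_simps)
  then show ?thesis unfolding I_def by (simp add: complex_eq_iff)
qed

text \<open>Expand \<open>h\<close> in its Taylor series about \<open>z\<close> and integrate term
  by term: every power \<open>w ^ n\<close> with \<open>n > 0\<close> contributes 0, so only the
  constant term remains.\<close>

lemma integral_cball_entire:
  fixes h :: "complex \<Rightarrow> complex"
  assumes "h holomorphic_on UNIV" and "r > 0"
  shows "(\<integral>w. indicator (cball 0 r) w *\<^sub>R h (z + w) \<partial>lborel) = of_real (measure lborel (cball 0 r :: complex set)) * h z"
proof -
  define a where "a n = (deriv ^^ n) h z / fact n" for n
  define f where "f n w = indicator (cball 0 r) w *\<^sub>R (a n * w ^ n)" for n and w :: complex
  have sums: "(\<lambda>n. a n * w ^ n) sums h (z + w)" for w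
    using holomorphic_power_series[of h z "norm w + 1" "z + w"] assms(1)
    by (auto simp: a_def dist_norm intro: holomorphic_on_subset)
  \<comment> \<open>Convergence at the larger radius \<open>r + 1\<close> gives absolute convergence
    at radius \<open>r\<close>, hence the majorant that justifies exchanging sum and
    integral.\<close>
  have "summable (\<lambda>n. norm (a n * of_real r ^ n))"
    using sums[of "of_real (r + 1)"] \<open>r > 0\<close>
    by (intro powser_insidea[of _ "of_real (r + 1)"]) (auto simp del: of_real_add simp: sums_iff)
  then have summ: "summable (\<lambda>n. norm (a n) * r ^ n)"
    using \<open>r > 0\<close> by (simp add: norm_mult norm_power)
  have int: "integrable lborel (f n)" for n
    unfolding f_def by (intro borel_integrable_compact continuous_intros) auto
  have bound: "norm (f n w) \<le> norm (a n) * r ^ n * indicator (cball 0 r) w" for n w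
    by (auto simp: f_def indicator_def norm_mult norm_power intro!: mult_left_mono power_mono)
  have intc: "integrable lborel (\<lambda>w :: complex. indicator (cball 0 r) w :: real)"
    using emeasure_lborel_cball_finite[of "0::complex" r] by (intro integrable_real_indicator) auto
  have 1: "AE w in lborel. summable (\<lambda>n. norm (f n w))"
  proof (rule AE_I2)
    fix w :: complex
    have "summable (\<lambda>n. norm (a n) * r ^ n * indicator (cball 0 r) w)"
      by (intro summable_mult2 summ)
    then show "summable (\<lambda>n. norm (f n w))"
      by (rule summable_comparison_test') (use bound in auto)
  qed
  have 2: "summable (\<lambda>n. \<integral>w. norm (f n w) \<partial>lborel)"
  proof (rule summable_comparison_test'[of "\<lambda>n. norm (a n) * r ^ n * (\<integral>w. indicator (cball 0 r) w \<partial>(lborel :: complex measure))"])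
    show "summable (\<lambda>n. norm (a n) * r ^ n * (\<integral>w. indicator (cball 0 r) w \<partial>(lborel :: complex measure)))"
      by (intro summable_mult2 summ)
    fix n :: nat
    have "(\<integral>w. norm (f n w) \<partial>lborel) \<le> (\<integral>w. norm (a n) * r ^ n * indicator (cball 0 r) w \<partial>(lborel :: complex measure))"
    proof (rule Bochner_Integration.integral_mono)
      show "integrable lborel (\<lambda>w. norm (a n) * r ^ n * indicator (cball 0 r) (w :: complex) :: real)"
        using intc by simp
    qed (use int bound in auto)
    then show "norm (\<integral>w. norm (f n w) \<partial>lborel) \<le> norm (a n) * r ^ n * (\<integral>w. indicator (cball 0 r) w \<partial>(lborel :: complex measure))"
      by simp
  qed
  have "(\<integral>w. indicator (cball 0 r) w *\<^sub>R h (z + w) \<partial>lborel) = (\<integral>w. (\<Sum>n. f n w) \<partial>lborel)"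
  proof (intro Bochner_Integration.integral_cong refl)
    fix w :: complex
    have "(\<lambda>n. f n w) sums (indicator (cball 0 r) w *\<^sub>R h (z + w))"
      unfolding f_def by (intro sums_scaleR_right sums)
    then show "indicator (cball 0 r) w *\<^sub>R h (z + w) = (\<Sum>n. f n w)"
      by (simp add: sums_iff)
  qed
  also have "\<dots> = (\<Sum>n. \<integral>w. f n w \<partial>lborel)"
    by (rule integral_suminf[OF int 1 2])
  also have "\<dots> = (\<Sum>n\<in>{0}. \<integral>w. f n w \<partial>lborel)"
  proof (rule suminf_finite)
    fix n :: nat assume "n \<notin> {0}"
    have "(\<integral>w. f n w \<partial>lborel) = (\<integral>w. a n * (indicator (cball 0 r) w *\<^sub>R w ^ n) \<partial>lborel)"
      by (simp add: f_def)
    also have "\<dots> = 0"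
      using integral_cball_power_eq_0[of n r] \<open>n \<notin> {0}\<close> by (simp del: mult_scaleR_right)
    finally show "(\<integral>w. f n w \<partial>lborel) = 0" .
  qed simp
  also have "\<dots> = (\<integral>w. indicator (cball 0 r) w *\<^sub>R h z \<partial>(lborel :: complex measure))"
    by (simp add: f_def a_def)
  also have "\<dots> = of_real (measure lborel (cball 0 r :: complex set)) * h z"
    using emeasure_lborel_cball_finite[of "0::complex" r] by (simp add: less_top scaleR_conv_of_real)
  finally show ?thesis .
qed

text \<open>The triangle inequality applied to the area mean value. With an extended nonnegative
  integral on the right, the disc can later be enlarged by monotonicity alone.\<close>

lemma norm_entire_le_integral_cball:
  fixes h :: "complex \<Rightarrow> complex"
  assumes "h holomorphic_on UNIV" and "r > 0"
  shows "ennreal (measure lborel (cball 0 r :: complex set) * norm (h z))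
    \<le> (\<integral>\<^sup>+w. indicator (cball z r) w * ennreal (norm (h w)) \<partial>lborel)"
proof -
  have cont: "continuous_on UNIV h"
    using assms(1) by (rule holomorphic_on_imp_continuous_on)
  then have [measurable]: "h \<in> borel_measurable borel"
    by (rule borel_measurable_continuous_onI)
  have [measurable]: "cball z r \<in> sets borel"
    by simp
  let ?f = "\<lambda>w. indicator (cball 0 r) w *\<^sub>R h (z + w)"
  have "integrable lborel ?f"
    by (intro borel_integrable_compact continuous_intros continuous_on_compose2[OF cont]) auto
  then have "ennreal (norm (integral\<^sup>L lborel ?f)) \<le> (\<integral>\<^sup>+w. ennreal (norm (?f w)) \<partial>lborel)"
    by (rule integral_norm_bound_ennreal)
  also have "norm (integral\<^sup>L lborel ?f) = measure lborel (cball 0 r :: complex set) * norm (h z)"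
    by (simp add: integral_cball_entire[OF assms] norm_mult)
  also have "(\<integral>\<^sup>+w. ennreal (norm (?f w)) \<partial>lborel)
      = (\<integral>\<^sup>+w. indicator (cball z r) (z + w) * ennreal (norm (h (z + w))) \<partial>lborel)"
    by (intro nn_integral_cong) (auto simp: indicator_def dist_norm)
  also have "\<dots> = (\<integral>\<^sup>+w. indicator (cball z r) w * ennreal (norm (h w)) \<partial>distr lborel borel ((+) z))"
    by (subst nn_integral_distr) measurable
  finally show ?thesis by (simp add: lborel_distr_plus)
qed

subsection \<open>Local bounds in the Bargmann space\<close>

text \<open>Completing the square:
  \<open>|w - z|^2 = |w|^2 - 2 * Re (cnj z * w) + |z|^2\<close>.\<close>

lemma exp_cnj_factor:
  "(cmod (exp (- (cnj z * w) + (of_real (cmod z))\<^sup>2 / 2)))\<^sup>2 = exp (- (cmod w)\<^sup>2) * exp ((cmod (w - z))\<^sup>2)"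
proof -
  have r: "Re ((of_real (cmod z))\<^sup>2 / 2) = (cmod z)\<^sup>2 / 2"
    by (simp flip: of_real_power)
  have "(cmod (exp (- (cnj z * w) + (of_real (cmod z))\<^sup>2 / 2)))\<^sup>2
      = exp (2 * Re (- (cnj z * w) + (of_real (cmod z))\<^sup>2 / 2))"
    by (simp add: power2_eq_square flip: exp_add)
  also have "2 * Re (- (cnj z * w) + (of_real (cmod z))\<^sup>2 / 2) = - (cmod w)\<^sup>2 + (cmod (w - z))\<^sup>2"
    unfolding plus_complex.sel r by (simp add: cmod_power2 algebra_simps power2_diff)
  finally show ?thesis by (simp only: exp_add)
qed

text \<open>Multiplying by \<open>exp (|z|\<^sup>2/2 - cnj z w)\<close> keeps \<open>\<phi>\<close> entire while turning \<open>|\<phi> w|\<^sup>2\<close> into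
  \<open>|\<phi> w|\<^sup>2 exp (-|w|\<^sup>2)\<close> up to the factor \<open>exp (|w - z|\<^sup>2)\<close>, which is bounded near \<open>z\<close>.\<close>

lemma entire_gaussian_local_bounds:
  fixes \<phi> :: "complex \<Rightarrow> complex" and z :: complex and M :: real
  assumes holo: "\<phi> holomorphic_on UNIV"
    and M: "(\<integral>\<^sup>+w. indicator (cball z 2) w * ennreal ((cmod (\<phi> w))\<^sup>2 * exp (- (cmod w)\<^sup>2)) \<partial>lborel) \<le> ennreal M"
    and "M \<ge> 0"
  defines "C \<equiv> exp 4 / measure lborel (cball 0 1 :: complex set)"
  shows "(cmod (\<phi> z))\<^sup>2 * exp (- (cmod z)\<^sup>2) \<le> C * M"
    and "(cmod (deriv \<phi> z))\<^sup>2 * exp (- (cmod z)\<^sup>2) \<le> (1 + cmod z)\<^sup>2 * (C * M)"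
proof -
  define c where "c = measure lborel (cball 0 1 :: complex set)"
  have "c > 0"
    unfolding c_def using content_cball_pos[of 1 "0::complex"] by simp
  define g where "g w = \<phi> w * exp (- (cnj z * w) + (of_real (cmod z))\<^sup>2 / 2)" for w
  have g_sq: "(cmod (g w))\<^sup>2 = (cmod (\<phi> w))\<^sup>2 * exp (- (cmod w)\<^sup>2) * exp ((cmod (w - z))\<^sup>2)" for w
    by (simp only: g_def norm_mult power_mult_distrib exp_cnj_factor mult.assoc)
  have holo_g: "g holomorphic_on UNIV"
    unfolding g_def by (intro holomorphic_intros holo)
  have [measurable]: "\<phi> \<in> borel_measurable borel"
    by (rule borel_measurable_continuous_onI[OF holomorphic_on_imp_continuous_on[OF holo]])
  have [measurable]: "cball z 2 \<in> sets borel"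
    by simp
  \<comment> \<open>The bound is needed on the whole unit disc around \<open>z\<close>, because
    Cauchy's inequality for \<open>deriv g z\<close> uses it there. Unit discs centred in it stay
    inside \<open>cball z 2\<close>, where \<open>exp (|v - z|^2)\<close> is at most
    \<open>exp 4\<close>.\<close>
  have near: "(cmod (g w))\<^sup>2 \<le> C * M" if "cmod (w - z) \<le> 1" for w
  proof -
    \<comment> \<open>The mean value bound is applied to the entire function \<open>g ^ 2\<close>,
      which turns it into a bound by an integral of \<open>|g|^2\<close>.\<close>
    have "ennreal (c * norm (g w ^ 2)) \<le> (\<integral>\<^sup>+v. indicator (cball w 1) v * ennreal (norm (g v ^ 2)) \<partial>lborel)"
      unfolding c_def using norm_entire_le_integral_cball[of "\<lambda>v. g v ^ 2" 1 w] holo_g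
      by (auto intro: holomorphic_intros)
    also have "\<dots> \<le> (\<integral>\<^sup>+v. ennreal (exp 4) * (indicator (cball z 2) v * ennreal ((cmod (\<phi> v))\<^sup>2 * exp (- (cmod v)\<^sup>2))) \<partial>lborel)"
    proof (rule nn_integral_mono)
      fix v
      have "norm (g v ^ 2) \<le> exp 4 * ((cmod (\<phi> v))\<^sup>2 * exp (- (cmod v)\<^sup>2)) \<and> v \<in> cball z 2"
        if "v \<in> cball w 1"
      proof -
        have "cmod (v - z) \<le> cmod (v - w) + cmod (w - z)"
          using norm_triangle_ineq[of "v - w" "w - z"] by simp
        with that \<open>cmod (w - z) \<le> 1\<close> have le: "cmod (v - z) \<le> 2"
          by (simp add: dist_norm norm_minus_commute)
        then have "(cmod (v - z))\<^sup>2 \<le> 4"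
          using power_mono[of "cmod (v - z)" 2 2] by simp
        then have "(cmod (\<phi> v))\<^sup>2 * exp (- (cmod v)\<^sup>2) * exp ((cmod (v - z))\<^sup>2) \<le> (cmod (\<phi> v))\<^sup>2 * exp (- (cmod v)\<^sup>2) * exp 4"
          by (intro mult_left_mono) auto
        with le show ?thesis
          by (simp add: norm_power g_sq mult_ac dist_norm norm_minus_commute)
      qed
      then show "indicator (cball w 1) v * ennreal (norm (g v ^ 2))
          \<le> ennreal (exp 4) * (indicator (cball z 2) v * ennreal ((cmod (\<phi> v))\<^sup>2 * exp (- (cmod v)\<^sup>2)))"
        by (auto simp: indicator_def ennreal_mult[symmetric] simp del: mem_cball)
    qed
    also have "\<dots> = ennreal (exp 4) * (\<integral>\<^sup>+v. indicator (cball z 2) v * ennreal ((cmod (\<phi> v))\<^sup>2 * exp (- (cmod v)\<^sup>2)) \<partial>lborel)"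
      by (rule nn_integral_cmult) measurable
    also have "\<dots> \<le> ennreal (exp 4) * ennreal M"
      by (intro mult_left_mono M) simp
    also have "\<dots> = ennreal (exp 4 * M)"
      using \<open>M \<ge> 0\<close> by (simp add: ennreal_mult)
    finally have "c * norm (g w ^ 2) \<le> exp 4 * M"
      using \<open>M \<ge> 0\<close> by simp
    then show ?thesis
      using \<open>c > 0\<close> unfolding C_def c_def[symmetric] by (simp add: field_simps norm_power)
  qed
  show 1: "(cmod (\<phi> z))\<^sup>2 * exp (- (cmod z)\<^sup>2) \<le> C * M"
    using near[of z] by (simp add: g_sq)
  define B where "B = sqrt (C * M)"
  have "C * M \<ge> 0" using near[of z] by (rule order_trans[rotated]) auto
  then have B: "B \<ge> 0" "B\<^sup>2 = C * M" by (auto simp: B_def)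
  have near': "cmod (g w) \<le> B" if "cmod (w - z) \<le> 1" for w
    unfolding B_def using near[OF that] by (rule real_le_rsqrt)
  have "cmod ((deriv ^^ 1) g z) \<le> fact 1 * B / 1 ^ 1"
    using holo_g holomorphic_on_imp_continuous_on[OF holo_g]
    by (intro Cauchy_inequality near')
      (auto intro: holomorphic_on_subset continuous_on_subset simp: norm_minus_commute)
  then have dg: "cmod (deriv g z) \<le> B" by simp
  define E where "E = exp (- (cmod z)\<^sup>2 / 2)"
  have E: "E > 0" "E\<^sup>2 = exp (- (cmod z)\<^sup>2)"
    by (auto simp: E_def power2_eq_square simp flip: exp_add)
  have expE: "exp (- (cnj z * z) + (of_real (cmod z))\<^sup>2 / 2) = of_real E"
    unfolding E_def by (simp add: complex_norm_square[symmetric] mult.commute[of "cnj z"] flip: exp_of_real of_real_power)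
  then have expE': "exp ((of_real (cmod z))\<^sup>2 / 2 - z * cnj z) = of_real E"
    by (simp add: mult.commute)
  have "(\<phi> has_field_derivative deriv \<phi> z) (at z)"
    using holo by (simp add: holomorphic_derivI)
  \<comment> \<open>At \<open>w = z\<close> the exponential factor equals \<open>E\<close>, and its
    derivative contributes \<open>- cnj z * g z\<close>. This term is the source of the factor
    \<open>1 + cmod z\<close>.\<close>
  then have "(g has_field_derivative deriv \<phi> z * of_real E - cnj z * g z) (at z)"
    unfolding g_def by (auto intro!: derivative_eq_intros simp: expE expE' algebra_simps)
  then have "deriv g z = deriv \<phi> z * of_real E - cnj z * g z"
    by (rule DERIV_imp_deriv)
  then have "deriv \<phi> z * of_real E = deriv g z + cnj z * g z"
    by simp
  moreover have "cmod (deriv \<phi> z) * E = cmod (deriv \<phi> z * of_real E)"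
    using \<open>E > 0\<close> by (simp add: norm_mult)
  ultimately have "cmod (deriv \<phi> z) * E \<le> cmod (deriv g z) + cmod z * cmod (g z)"
    using norm_triangle_ineq[of "deriv g z" "cnj z * g z"] by (simp only: norm_mult complex_mod_cnj)
  also have "\<dots> \<le> B + cmod z * B"
    using dg near'[of z] by (intro add_mono mult_left_mono) auto
  finally have "(cmod (deriv \<phi> z) * E)\<^sup>2 \<le> ((1 + cmod z) * B)\<^sup>2"
    using E by (intro power_mono) (auto simp: algebra_simps)
  then show "(cmod (deriv \<phi> z))\<^sup>2 * exp (- (cmod z)\<^sup>2) \<le> (1 + cmod z)\<^sup>2 * (C * M)"
    by (simp add: power_mult_distrib E B)
qed

text \<open>The dominating function is the mass of \<open>|\<phi>|\<^sup>2 exp (-|w|\<^sup>2)\<close> in the disc of radius 2 around \<open>\<i> y\<close>;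
  by Tonelli its integral over \<open>y\<close> is at most 4 times the total mass.\<close>

lemma bargmann_imaginary_axis_bounds:
  assumes "bargmann \<phi>"
  obtains F :: "real \<Rightarrow> real" and K :: real where
    "integrable lborel F" "\<And>y. 0 \<le> F y" "\<And>y. F y \<le> K"
    "\<And>y. (cmod (\<phi> (\<i> * of_real y)))\<^sup>2 * exp (- y\<^sup>2) \<le> F y"
    "\<And>y. (cmod (deriv \<phi> (\<i> * of_real y)))\<^sup>2 * exp (- y\<^sup>2) \<le> (1 + \<bar>y\<bar>)\<^sup>2 * F y"
proof -
  define H where "H w = (cmod (\<phi> w))\<^sup>2 * exp (- (cmod w)\<^sup>2)" for w
  have holo: "\<phi> holomorphic_on UNIV" and int: "H integrable_on UNIV"
    using assms unfolding bargmann_def H_def by auto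
  have [measurable]: "\<phi> \<in> borel_measurable borel"
    by (rule borel_measurable_continuous_onI[OF holomorphic_on_imp_continuous_on[OF holo]])
  have [measurable]: "H \<in> borel_measurable borel"
    unfolding H_def by measurable
  have H0: "H w \<ge> 0" for w by (simp add: H_def)
  define I where "I = integral UNIV H"
  have "I \<ge> 0" unfolding I_def by (intro integral_nonneg int) (simp add: H0)
  have nnH: "(\<integral>\<^sup>+w. ennreal (H w) \<partial>lborel) = ennreal I"
    using int H0 unfolding I_def by (intro nn_integral_has_integral_lborel integrable_integral) auto
  define N where "N y = (\<integral>\<^sup>+w. indicator (cball (\<i> * of_real y) 2) w * ennreal (H w) \<partial>lborel)" for y :: real
  have N_le: "N y \<le> ennreal I" for y
    unfolding N_def nnH[symmetric] by (intro nn_integral_mono) (auto simp: indicator_def)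
  have pair: "(\<lambda>(y, w). indicator (cball (\<i> * of_real y) 2) w * ennreal (H w)) \<in> borel_measurable (lborel \<Otimes>\<^sub>M lborel)"
  proof -
    \<comment> \<open>The disc moves with \<open>y\<close>; writing its indicator as that of a
      closed subset of the product makes joint measurability visible.\<close>
    have "(\<lambda>(y :: real, w). indicator (cball (\<i> * of_real y) 2) w * ennreal (H w))
      = (\<lambda>p. indicator {p. dist (\<i> * of_real (fst p)) (snd p) \<le> 2} p * ennreal (H (snd p)))"
      by (auto simp: fun_eq_iff indicator_def)
    also have "\<dots> \<in> borel_measurable (lborel \<Otimes>\<^sub>M lborel)"
      by measurable
    finally show ?thesis .
  qed
  have [measurable]: "N \<in> borel_measurable borel"
    unfolding N_def using lborel.borel_measurable_nn_integral_fst[OF pair] by simp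
  have "(\<integral>\<^sup>+y. N y \<partial>lborel)
      = (\<integral>\<^sup>+w. (\<integral>\<^sup>+y. indicator (cball (\<i> * of_real y) 2) w * ennreal (H w) \<partial>lborel) \<partial>lborel)"
    unfolding N_def by (rule lborel_pair.Fubini'[OF pair, symmetric])
  also have "\<dots> \<le> (\<integral>\<^sup>+w. ennreal 4 * ennreal (H w) \<partial>lborel)"
  proof (rule nn_integral_mono)
    fix w
    have "(\<integral>\<^sup>+y. indicator (cball (\<i> * of_real y) 2) w * ennreal (H w) \<partial>lborel)
        \<le> (\<integral>\<^sup>+y. ennreal (H w) * indicator {Im w - 2..Im w + 2} y \<partial>lborel)"
    proof (intro nn_integral_mono)
      fix y :: real
      have "\<bar>Im w - y\<bar> \<le> 2" if "w \<in> cball (\<i> * of_real y) 2"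
        using that abs_Im_le_cmod[of "w - \<i> * of_real y"] by (simp add: dist_norm norm_minus_commute)
      then show "indicator (cball (\<i> * of_real y) 2) w * ennreal (H w) \<le> ennreal (H w) * indicator {Im w - 2..Im w + 2} y"
        by (auto simp: indicator_def simp del: mem_cball)
    qed
    also have "\<dots> = ennreal (H w) * ennreal 4"
      by (subst nn_integral_cmult_indicator) auto
    finally show "(\<integral>\<^sup>+y. indicator (cball (\<i> * of_real y) 2) w * ennreal (H w) \<partial>lborel) \<le> ennreal 4 * ennreal (H w)"
      by (simp add: mult.commute)
  qed
  also have "\<dots> = ennreal 4 * ennreal I"
    by (subst nn_integral_cmult) (simp_all add: nnH)
  also have "\<dots> < \<infinity>"
    by (simp add: ennreal_mult_less_top)
  finally have intN: "(\<integral>\<^sup>+y. N y \<partial>lborel) < \<infinity>" .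
  define m where "m y = enn2real (N y)" for y
  have m: "ennreal (m y) = N y" for y
    unfolding m_def using N_le[of y] by (intro ennreal_enn2real) (auto simp: less_top[symmetric] top_unique)
  have m0: "m y \<ge> 0" for y by (simp add: m_def)
  have [measurable]: "m \<in> borel_measurable borel" unfolding m_def by measurable
  have int_m: "integrable lborel m"
    using intN by (intro integrableI_nonneg) (auto simp: m m0)
  have m_le: "m y \<le> I" for y
    using N_le[of y] \<open>I \<ge> 0\<close> by (simp flip: m)
  define C where "C = exp 4 / measure lborel (cball 0 1 :: complex set)"
  have "C \<ge> 0" by (simp add: C_def)
  \<comment> \<open>With \<open>M = m y\<close> the mass hypothesis collapses to
    \<open>N y \<le> N y\<close>.\<close>
  note local = entire_gaussian_local_bounds[OF holo, of "\<i> * of_real y" "m y" for y, folded H_def C_def, folded N_def, unfolded m]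
  show ?thesis
  proof
    show "integrable lborel (\<lambda>y. C * m y)" using int_m by simp
    show "0 \<le> C * m y" for y using \<open>C \<ge> 0\<close> m0 by simp
    show "C * m y \<le> C * I" for y using \<open>C \<ge> 0\<close> m_le by (intro mult_left_mono)
    show "(cmod (\<phi> (\<i> * of_real y)))\<^sup>2 * exp (- y\<^sup>2) \<le> C * m y" for y
    proof -
      have "H (\<i> * of_real y) \<le> C * m y" using local(1)[of y] m0 by simp
      then show ?thesis by (simp add: H_def norm_mult)
    qed
    show "(cmod (deriv \<phi> (\<i> * of_real y)))\<^sup>2 * exp (- y\<^sup>2) \<le> (1 + \<bar>y\<bar>)\<^sup>2 * (C * m y)" for y
      using local(2)[of y] m0 by (simp add: norm_mult)
  qed
qed

subsection \<open>Integrals over half-lines and the tail of the kernel\<close>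

text \<open>Transfers the fundamental theorem from the Lebesgue interval integral to the gauge
  integral. Absolute integrability is assumed because a vector-valued integrand has no sign to
  derive it from.\<close>

lemma has_integral_FTC_Iio:
  fixes F f :: "real \<Rightarrow> 'a::euclidean_space"
  assumes "\<And>x. x < b \<Longrightarrow> (F has_vector_derivative f x) (at x)"
    and "\<And>x. x < b \<Longrightarrow> isCont f x"
    and "set_integrable lborel {..<b} f"
    and "(F \<longlongrightarrow> A) at_bot" and "(F \<longlongrightarrow> B) (at_left b)"
  shows "(f has_integral B - A) {..<b}"
proof -
  have e: "einterval (-\<infinity>) (ereal b) = {..<b}"
    by (auto simp: einterval_def)
  have "(LBINT x=-\<infinity>..ereal b. f x) = B - A"
    using assms by (intro interval_integral_FTC_integrable) (auto simp: e ereal_tendsto_simps)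
  moreover have "(LBINT x=-\<infinity>..ereal b. f x) = integral {..<b} f"
    using assms(3) by (subst interval_integral_eq_integral') (auto simp: e)
  ultimately show ?thesis
    using set_borel_integral_eq_integral(1)[OF assms(3)] by (metis integrable_integral)
qed

text \<open>For a nonnegative derivative, finite limits of the primitive already force
  integrability.\<close>

lemma integrable_FTC_Iio_nonneg:
  fixes F f :: "real \<Rightarrow> real"
  assumes "\<And>x. x < b \<Longrightarrow> (F has_real_derivative f x) (at x)"
    and "\<And>x. x < b \<Longrightarrow> isCont f x" and "\<And>x. x < b \<Longrightarrow> 0 \<le> f x"
    and "(F \<longlongrightarrow> A) at_bot" and "(F \<longlongrightarrow> B) (at_left b)"
  shows "set_integrable lborel {..<b} f" and "(f has_integral B - A) {..<b}"
proof -
  have e: "einterval (-\<infinity>) (ereal b) = {..<b}"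
    by (auto simp: einterval_def)
  show int: "set_integrable lborel {..<b} f"
    using assms by (subst e[symmetric], intro interval_integral_FTC_nonneg(1)[where F = F and A = A and B = B])
      (auto simp: ereal_tendsto_simps)
  show "(f has_integral B - A) {..<b}"
    using assms int by (intro has_integral_FTC_Iio) (auto simp: has_real_derivative_iff_has_vector_derivative)
qed

text \<open>A single endpoint is negligible. The kernel integrates over closed half-lines, the
  fundamental theorem above over open ones.\<close>

lemma has_integral_Iic_iff_Iio:
  fixes f :: "real \<Rightarrow> 'a::banach"
  shows "(f has_integral I) {..b} \<longleftrightarrow> (f has_integral I) {..<b}"
  by (rule has_integral_spike_set_eq; rule negligible_subset[of "{b}"]) auto

lemma tendsto_exp_mult_at_bot:
  fixes a :: real
  assumes "a > 0"
  shows "((\<lambda>x. exp (a * x)) \<longlongrightarrow> 0) at_bot"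
  using assms by (intro filterlim_compose[OF exp_at_bot] filterlim_tendsto_pos_mult_at_bot[OF tendsto_const])
    (auto simp: filterlim_ident)

lemma set_integrable_exp_Iio:
  fixes a b :: real
  assumes "a > 0"
  shows "set_integrable lborel {..<b} (\<lambda>x. exp (a * x))"
proof (rule integrable_FTC_Iio_nonneg(1))
  show "((\<lambda>x. exp (a * x) / a) has_real_derivative exp (a * x)) (at x)" for x
    using assms by (auto intro!: derivative_eq_intros)
  show "((\<lambda>x. exp (a * x) / a) \<longlongrightarrow> 0 / a) at_bot"
    using assms by (intro tendsto_intros tendsto_exp_mult_at_bot) auto
  show "((\<lambda>x. exp (a * x) / a) \<longlongrightarrow> exp (a * b) / a) (at_left b)"
    using assms by (intro tendsto_intros) auto
qed auto

text \<open>The integrand is the exact derivative of \<open>exp (- u^2 / 2)\<close>. Its closed-form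
  tail serves as majorant for the kernel, whose own integral is not elementary.\<close>

lemma
  fixes s :: real
  assumes "s < 0"
  shows set_integrable_gaussian_moment: "set_integrable lborel {..<s} (\<lambda>u. - u * exp (- u\<^sup>2 / 2))"
    and has_integral_gaussian_moment: "((\<lambda>u. - u * exp (- u\<^sup>2 / 2)) has_integral exp (- s\<^sup>2 / 2)) {..<s}"
proof -
  have d: "((\<lambda>u. exp (- u\<^sup>2 / 2)) has_real_derivative - u * exp (- u\<^sup>2 / 2)) (at u)" for u :: real
    by (auto intro!: derivative_eq_intros)
  have n: "0 \<le> - u * exp (- u\<^sup>2 / 2)" if "u < s" for u
    using that assms by (simp add: mult_nonpos_nonneg)
  \<comment> \<open>For \<open>u \<le> -2\<close> the product \<open>u * (u + 2)\<close> is
    nonnegative, which says \<open>- u^2 / 2 \<le> u\<close>.\<close>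
  have "eventually (\<lambda>u::real. norm (exp (- u\<^sup>2 / 2)) \<le> exp u) at_bot"
    using eventually_le_at_bot[of "-2"]
  proof eventually_elim
    case (elim u)
    then have "0 \<le> u * (u + 2)" by (intro mult_nonpos_nonpos) auto
    then show ?case by (simp add: power2_eq_square algebra_simps)
  qed
  then have 0: "((\<lambda>u::real. exp (- u\<^sup>2 / 2)) \<longlongrightarrow> 0) at_bot"
    using exp_at_bot by (rule Lim_null_comparison)
  have s: "((\<lambda>u. exp (- u\<^sup>2 / 2)) \<longlongrightarrow> exp (- s\<^sup>2 / 2)) (at_left s)"
    by (intro tendsto_intros) auto
  show "set_integrable lborel {..<s} (\<lambda>u. - u * exp (- u\<^sup>2 / 2))"
    by (rule integrable_FTC_Iio_nonneg(1)[OF d _ n 0 s]) auto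
  have "((\<lambda>u. - u * exp (- u\<^sup>2 / 2)) has_integral exp (- s\<^sup>2 / 2) - 0) {..<s}"
    by (rule integrable_FTC_Iio_nonneg(2)[OF d _ n 0 s]) auto
  then show "((\<lambda>u. - u * exp (- u\<^sup>2 / 2)) has_integral exp (- s\<^sup>2 / 2)) {..<s}" by simp
qed

section \<open>The inner integral of the kernel as a function of its upper limit\<close>

definition kernel_weight :: "real \<Rightarrow> real \<Rightarrow> real" where
  "kernel_weight \<rho> u = exp (- ((u - \<rho>)\<^sup>2) / 2) / u"

text \<open>The primitive of the weight that vanishes at minus infinity. It is evaluated only at
  negative arguments, since the weight has a pole at 0.\<close>

definition kernel_tail :: "real \<Rightarrow> real \<Rightarrow> real" where
  "kernel_tail \<rho> s = integral {..s} (kernel_weight \<rho>)"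

text \<open>Exhibits \<open>exp (\<rho> * u - u^2 / 2)\<close>, the integrating factor of the
  differential equation. The constant in front later cancels
  \<open>exp (\<rho>^2 / 2)\<close>.\<close>

lemma kernel_weight_eq:
  "kernel_weight \<rho> u = exp (- \<rho>\<^sup>2 / 2) * exp (\<rho> * u - u\<^sup>2 / 2) / u"
  unfolding kernel_weight_def by (simp add: power2_diff field_simps flip: exp_add)

text \<open>Uses \<open>1 / |u| \<le> |u| / s^2\<close> and
  \<open>exp (\<rho> * u) \<le> exp (\<rho> * s)\<close>; what is left is the Gaussian moment with
  its elementary primitive.\<close>

lemma abs_kernel_weight_le:
  assumes "\<rho> > 0" "s < 0" "u \<le> s"
  shows "\<bar>kernel_weight \<rho> u\<bar> \<le> exp (\<rho> * s) / s\<^sup>2 * (- u * exp (- u\<^sup>2 / 2))"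
proof -
  have "s\<^sup>2 \<le> u\<^sup>2" using assms by (simp add: power2_le_iff_abs_le abs_le_square_iff[symmetric])
  then have "s\<^sup>2 * (1 / \<bar>u\<bar>) \<le> u\<^sup>2 * (1 / \<bar>u\<bar>)" by (intro mult_right_mono) auto
  also have "\<dots> = - u" using assms by (simp add: power2_eq_square)
  finally have 1: "1 / \<bar>u\<bar> \<le> - u / s\<^sup>2" using assms by (intro mult_imp_le_div_pos) (auto simp: mult.commute)
  have "exp (- \<rho>\<^sup>2 / 2) * exp (\<rho> * u) \<le> 1 * exp (\<rho> * s)"
    using assms by (intro mult_mono) auto
  then have "exp (- \<rho>\<^sup>2 / 2) * exp (\<rho> * u) * exp (- u\<^sup>2 / 2) * (1 / \<bar>u\<bar>) \<le> exp (\<rho> * s) * exp (- u\<^sup>2 / 2) * (- u / s\<^sup>2)"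
    using 1 by (intro mult_mono) auto
  also have "exp (- \<rho>\<^sup>2 / 2) * exp (\<rho> * u) * exp (- u\<^sup>2 / 2) * (1 / \<bar>u\<bar>) = \<bar>kernel_weight \<rho> u\<bar>"
    unfolding kernel_weight_eq by (simp add: abs_mult mult_exp_exp mult.assoc)
  finally show ?thesis
    by (simp add: mult_ac)
qed

lemma continuous_on_kernel_weight:
  assumes "0 \<notin> A"
  shows "continuous_on A (kernel_weight \<rho>)"
  unfolding kernel_weight_def using assms by (intro continuous_intros) auto

lemma kernel_weight_integrable:
  assumes "\<rho> > 0" "s < 0"
  shows "kernel_weight \<rho> integrable_on {..s}"
proof -
  have [measurable]: "kernel_weight \<rho> \<in> borel_measurable borel"
    unfolding kernel_weight_def by measurable
  have "set_integrable lborel {..<s} (kernel_weight \<rho>)"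
  proof (rule set_integrable_bound)
    show "set_integrable lborel {..<s} (\<lambda>u. exp (\<rho> * s) / s\<^sup>2 * (- u * exp (- u\<^sup>2 / 2)))"
      using set_integrable_gaussian_moment[OF assms(2)] by (rule set_integrable_mult_right)
    show "set_borel_measurable lborel {..<s} (kernel_weight \<rho>)"
      unfolding set_borel_measurable_def by measurable
    show "AE u in lborel. u \<in> {..<s} \<longrightarrow> norm (kernel_weight \<rho> u)
        \<le> norm (exp (\<rho> * s) / s\<^sup>2 * (- u * exp (- u\<^sup>2 / 2)))"
    proof (intro AE_I2 impI)
      fix u assume "u \<in> {..<s}"
      then show "norm (kernel_weight \<rho> u) \<le> norm (exp (\<rho> * s) / s\<^sup>2 * (- u * exp (- u\<^sup>2 / 2)))"
        using order_trans[OF abs_kernel_weight_le[OF assms, of u] abs_ge_self] by simp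
    qed
  qed
  then show ?thesis
    using set_borel_integral_eq_integral(1) has_integral_Iic_iff_Iio unfolding integrable_on_def by blast
qed

text \<open>Integrates the pointwise bound. The factor \<open>exp (- s^2 / 2)\<close> exactly
  offsets the admissible growth of \<open>f\<close> and \<open>f'\<close> below, so that
  \<open>\<rho> > 0\<close> leaves exponential decay.\<close>

lemma abs_kernel_tail_le:
  assumes "\<rho> > 0" "s < 0"
  shows "\<bar>kernel_tail \<rho> s\<bar> \<le> exp (\<rho> * s - s\<^sup>2 / 2) / s\<^sup>2"
proof -
  have "((\<lambda>u. - u * exp (- u\<^sup>2 / 2)) has_integral exp (- s\<^sup>2 / 2)) {..s}"
    using has_integral_gaussian_moment[OF assms(2)] by (simp only: has_integral_Iic_iff_Iio)
  then have "((\<lambda>u. exp (\<rho> * s) / s\<^sup>2 * (- u * exp (- u\<^sup>2 / 2))) has_integral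
      exp (\<rho> * s) / s\<^sup>2 * exp (- s\<^sup>2 / 2)) {..s}"
    by (rule has_integral_mult_right)
  also have "exp (\<rho> * s) / s\<^sup>2 * exp (- s\<^sup>2 / 2) = exp (\<rho> * s - s\<^sup>2 / 2) / s\<^sup>2"
    by (simp add: mult_exp_exp)
  finally have *: "((\<lambda>u. exp (\<rho> * s) / s\<^sup>2 * (- u * exp (- u\<^sup>2 / 2))) has_integral
      exp (\<rho> * s - s\<^sup>2 / 2) / s\<^sup>2) {..s}" .
  have "norm (integral {..s} (kernel_weight \<rho>)) \<le> integral {..s} (\<lambda>u. exp (\<rho> * s) / s\<^sup>2 * (- u * exp (- u\<^sup>2 / 2)))"
    using abs_kernel_weight_le[OF assms] *
    by (intro integral_norm_bound_integral kernel_weight_integrable assms) auto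
  then show ?thesis by (simp only: integral_unique[OF *] kernel_tail_def real_norm_def)
qed

lemma kernel_tail_has_derivative:
  assumes "\<rho> > 0" "s < 0"
  shows "(kernel_tail \<rho> has_real_derivative kernel_weight \<rho> s) (at s)"
proof -
  \<comment> \<open>The tail is split at a fixed point left of \<open>s\<close>, and
    \<open>s / 2\<close> serves as right end: \<open>s < s / 2 < 0\<close> keeps the pole outside
    the compact interval.\<close>
  define c where "c = s - 1"
  have c: "c < s" "c < 0" using assms by (auto simp: c_def)
  have cont: "continuous_on {c..s/2} (kernel_weight \<rho>)"
    using assms by (intro continuous_on_kernel_weight) auto
  have eq: "kernel_tail \<rho> c + integral {c..x} (kernel_weight \<rho>) = kernel_tail \<rho> x" if "x \<in> {c<..<s/2}" for x
  proof -
    have u: "{..x} = {..c} \<union> {c..x}" "{..c} \<inter> {c..x} = {c}" using that by auto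
    have "kernel_weight \<rho> integrable_on {c..x}"
      using that by (intro integrable_continuous_real continuous_on_subset[OF cont]) auto
    then show ?thesis
      unfolding kernel_tail_def u(1) using c u(2)
      by (subst integral_Un) (auto intro!: kernel_weight_integrable assms)
  qed
  have "((\<lambda>x. integral {c..x} (kernel_weight \<rho>)) has_vector_derivative kernel_weight \<rho> s) (at s within {c..s/2})"
    using c assms by (intro integral_has_vector_derivative cont) auto
  moreover have "at s within {c..s/2} = at s"
    using c assms by (intro at_within_interior) simp
  ultimately have "((\<lambda>x. integral {c..x} (kernel_weight \<rho>)) has_real_derivative kernel_weight \<rho> s) (at s)"
    by (simp add: has_real_derivative_iff_has_vector_derivative)
  then have "((\<lambda>x. kernel_tail \<rho> c + integral {c..x} (kernel_weight \<rho>)) has_real_derivative kernel_weight \<rho> s) (at s)"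
    using DERIV_add[OF DERIV_const] by force
  then show ?thesis
    by (rule has_field_derivative_transform_within_open[of _ _ _ "{c<..<s/2}"]) (use c assms eq in auto)
qed

subsection \<open>The integral equation\<close>

text \<open>The minimum splits the half-line at \<open>y\<close>. On the left the differential
  equation supplies a primitive, whose value at \<open>y\<close> contains
  \<open>\<sigma> * kernel_tail \<rho> y * f y\<close>. On the right the tail is frozen and
  \<open>f 0 = 0\<close> produces the opposite term, so only the term with \<open>f' y\<close>
  survives.\<close>

lemma integral_kernel_tail_mult_deriv:
  fixes f f' f'' :: "real \<Rightarrow> complex" and \<sigma> :: complex and \<rho> C y :: real
  assumes "\<rho> > 0" "y < 0" "C \<ge> 0" "f 0 = 0"
    and f: "\<And>s. (f has_vector_derivative f' s) (at s)"
    and f': "\<And>s. (f' has_vector_derivative f'' s) (at s)"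
    and ode: "\<And>s. of_real s * f'' s + of_real (\<rho> * s - s\<^sup>2) * f' s = \<sigma> * f s"
    and f_bound: "\<And>s. cmod (f s) \<le> C * (1 + \<bar>s\<bar>) * exp (s\<^sup>2 / 2)"
    and f'_bound: "\<And>s. cmod (f' s) \<le> C * (1 + \<bar>s\<bar>) * exp (s\<^sup>2 / 2)"
  shows "(\<lambda>s. of_real (kernel_tail \<rho> (min y s)) * f' s) integrable_on {..<0}"
    and "\<sigma> * integral {..<0} (\<lambda>s. of_real (kernel_tail \<rho> (min y s)) * f' s)
      = - of_real (exp (- \<rho>\<^sup>2 / 2) * exp (\<rho> * y - y\<^sup>2 / 2)) * f' y"
proof -
  let ?G = "kernel_tail \<rho>"
  have cont_f': "continuous_on UNIV f'"
    using f' by (intro continuous_at_imp_continuous_on ballI) (auto intro: has_vector_derivative_continuous)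
  have dG: "((\<lambda>s. of_real (?G s) :: complex) has_vector_derivative of_real (kernel_weight \<rho> s)) (at s)"
    if "s < 0" for s
    using kernel_tail_has_derivative[OF \<open>\<rho> > 0\<close> that] by (rule has_vector_derivative_of_real)
  have contG: "isCont ?G s" if "s < 0" for s
    using kernel_tail_has_derivative[OF \<open>\<rho> > 0\<close> that] by (rule DERIV_isCont)
  \<comment> \<open>Once the Gaussians cancel, \<open>(1 + |s|) / s^2 = 1 / s^2 + 1 / |s|\<close>
    remains, and for \<open>s \<le> y\<close> this is largest at \<open>s = y\<close>.\<close>
  define k where "k = C * (1 / y\<^sup>2 + 1 / \<bar>y\<bar>)"
  have tail_bound: "cmod (of_real (?G s) * v) \<le> k * exp (\<rho> * s)"
    if "s \<le> y" "cmod v \<le> C * (1 + \<bar>s\<bar>) * exp (s\<^sup>2 / 2)" for s v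
  proof -
    have "s < 0" using that \<open>y < 0\<close> by simp
    have "cmod (of_real (?G s) * v) \<le> exp (\<rho> * s - s\<^sup>2 / 2) / s\<^sup>2 * (C * (1 + \<bar>s\<bar>) * exp (s\<^sup>2 / 2))"
      unfolding norm_mult norm_of_real
      using that abs_kernel_tail_le[OF \<open>\<rho> > 0\<close> \<open>s < 0\<close>] by (intro mult_mono) auto
    also have "\<dots> = exp (\<rho> * s - s\<^sup>2 / 2) * exp (s\<^sup>2 / 2) * (C * ((1 + \<bar>s\<bar>) / s\<^sup>2))"
      by simp
    also have "\<dots> = exp (\<rho> * s) * (C * ((1 + \<bar>s\<bar>) / s\<^sup>2))"
      by (simp add: mult_exp_exp)
    also have "(1 + \<bar>s\<bar>) / s\<^sup>2 = 1 / s\<^sup>2 + 1 / \<bar>s\<bar>"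
      using \<open>s < 0\<close> by (simp add: diff_divide_distrib power2_eq_square)
    also have "exp (\<rho> * s) * (C * (1 / s\<^sup>2 + 1 / \<bar>s\<bar>)) \<le> exp (\<rho> * s) * (C * (1 / y\<^sup>2 + 1 / \<bar>y\<bar>))"
    proof (intro mult_left_mono add_mono frac_le \<open>C \<ge> 0\<close>)
      show "y\<^sup>2 \<le> s\<^sup>2" using that \<open>y < 0\<close> by (simp flip: abs_le_square_iff)
    qed (use that \<open>y < 0\<close> in auto)
    finally show ?thesis by (simp add: k_def mult_ac)
  qed
  have int_left: "set_integrable lborel {..<y} (\<lambda>s. of_real (?G s) * f' s)"
  proof (rule set_integrable_bound)
    show "set_integrable lborel {..<y} (\<lambda>s. k * exp (\<rho> * s))"
      by (intro set_integrable_mult_right set_integrable_exp_Iio \<open>\<rho> > 0\<close>)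
    have "continuous_on {..<y} (\<lambda>s. of_real (?G s) * f' s)"
      using contG \<open>y < 0\<close> by (intro continuous_intros continuous_on_subset[OF cont_f'])
        (auto intro!: continuous_at_imp_continuous_on)
    then show "set_borel_measurable lborel {..<y} (\<lambda>s. of_real (?G s) * f' s)"
      by (simp add: set_borel_measurable_def borel_measurable_continuous_on_indicator)
    show "AE s in lborel. s \<in> {..<y} \<longrightarrow> norm (of_real (?G s) * f' s) \<le> norm (k * exp (\<rho> * s))"
      using tail_bound[OF _ f'_bound] by (intro AE_I2 impI) (force intro: order_trans[OF _ abs_ge_self])
  qed
  define J where "J = integral {..<y} (\<lambda>s. of_real (?G s) * f' s)"
  have J: "((\<lambda>s. of_real (?G s) * f' s) has_integral J) {..<y}"
    unfolding J_def using set_borel_integral_eq_integral(1)[OF int_left] by (rule integrable_integral)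
  define e where "e s = exp (- \<rho>\<^sup>2 / 2) * exp (\<rho> * s - s\<^sup>2 / 2)" for s
  \<comment> \<open>By the differential equation \<open>(e f')' = \<sigma> f kernel_weight\<close>, so this is a primitive of \<open>\<sigma> kernel_tail f'\<close>.\<close>
  define P where "P s = \<sigma> * (of_real (?G s) * f s) - of_real (e s) * f' s" for s
  have de: "((\<lambda>s. of_real (e s) :: complex) has_vector_derivative of_real (e s * (\<rho> - s))) (at s)" for s
    unfolding e_def by (intro has_vector_derivative_of_real) (auto intro!: derivative_eq_intros)
  have dP: "(P has_vector_derivative \<sigma> * (of_real (?G s) * f' s)) (at s)" if "s < 0" for s
  proof -
    have "(P has_vector_derivative \<sigma> * (of_real (?G s) * f' s + of_real (kernel_weight \<rho> s) * f s)
        - (of_real (e s) * f'' s + of_real (e s * (\<rho> - s)) * f' s)) (at s)"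
      unfolding P_def
      by (intro has_vector_derivative_diff has_vector_derivative_mult_right has_vector_derivative_mult dG de f f' that)
    moreover have "\<sigma> * (of_real (kernel_weight \<rho> s) * f s) = of_real (e s) * f'' s + of_real (e s * (\<rho> - s)) * f' s"
    proof -
      \<comment> \<open>Both sides are compared after multiplication by \<open>s\<close>, which
        matches the form of the equation; \<open>s \<noteq> 0\<close> is then cancelled.\<close>
      have "of_real s * (of_real (e s) * f'' s + of_real (e s * (\<rho> - s)) * f' s)
          = of_real (e s) * (of_real s * f'' s + of_real (\<rho> * s - s\<^sup>2) * f' s)"
        by (simp add: algebra_simps power2_eq_square)
      also have "\<dots> = of_real s * (\<sigma> * (of_real (kernel_weight \<rho> s) * f s))"
        unfolding ode using that by (simp add: kernel_weight_eq e_def)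
      finally show ?thesis using that by simp
    qed
    ultimately show ?thesis by (simp add: distrib_left)
  qed
  have lim_tail: "((\<lambda>s. of_real (?G s) * f s) \<longlongrightarrow> 0) at_bot"
  proof (rule Lim_null_comparison)
    show "\<forall>\<^sub>F s in at_bot. norm (of_real (?G s) * f s) \<le> k * exp (\<rho> * s)"
      using eventually_le_at_bot[of y] by eventually_elim (rule tail_bound[OF _ f_bound])
    show "((\<lambda>s. k * exp (\<rho> * s)) \<longlongrightarrow> 0) at_bot"
      using tendsto_exp_mult_at_bot[OF \<open>\<rho> > 0\<close>] by (rule tendsto_mult_right_zero)
  qed
  have lim_e: "((\<lambda>s. of_real (e s) * f' s) \<longlongrightarrow> 0) at_bot"
  proof (rule Lim_null_comparison)
    \<comment> \<open>Here no factor \<open>1 / s^2\<close> tames \<open>1 + |s|\<close>. Half of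
      the decay \<open>exp (\<rho> * s)\<close> is spent on it, at the price of the constant
      \<open>1 + 2 / \<rho>\<close>.\<close>
    show "((\<lambda>s. C * (1 + 2 / \<rho>) * exp (\<rho> / 2 * s)) \<longlongrightarrow> 0) at_bot"
      using tendsto_exp_mult_at_bot[of "\<rho> / 2"] \<open>\<rho> > 0\<close> by (intro tendsto_mult_right_zero) simp
    show "\<forall>\<^sub>F s in at_bot. norm (of_real (e s) * f' s) \<le> C * (1 + 2 / \<rho>) * exp (\<rho> / 2 * s)"
      using eventually_le_at_bot[of 0]
    proof eventually_elim
      case (elim s)
      have "0 \<le> \<rho> * - s" using elim \<open>\<rho> > 0\<close> by (intro mult_nonneg_nonneg) auto
      then have "1 \<le> exp (\<rho> / 2 * - s)" by simp
      moreover have "\<rho> / 2 * - s \<le> exp (\<rho> / 2 * - s)"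
        using exp_ge_add_one_self[of "\<rho> / 2 * - s"] by linarith
      then have "- s \<le> 2 / \<rho> * exp (\<rho> / 2 * - s)"
        using \<open>\<rho> > 0\<close> by (simp add: field_simps)
      ultimately have lin: "1 + \<bar>s\<bar> \<le> (1 + 2 / \<rho>) * exp (\<rho> / 2 * - s)"
        using elim unfolding distrib_right by linarith
      have "norm (of_real (e s) * f' s) \<le> 1 * exp (\<rho> * s - s\<^sup>2 / 2) * (C * (1 + \<bar>s\<bar>) * exp (s\<^sup>2 / 2))"
        unfolding norm_mult norm_of_real e_def abs_mult abs_exp_cancel
        by (intro mult_mono f'_bound) auto
      also have "\<dots> = exp (\<rho> * s - s\<^sup>2 / 2) * exp (s\<^sup>2 / 2) * (C * (1 + \<bar>s\<bar>))"
        by simp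
      also have "\<dots> = exp (\<rho> * s) * (C * (1 + \<bar>s\<bar>))"
        by (simp add: mult_exp_exp)
      also have "\<dots> \<le> exp (\<rho> * s) * (C * ((1 + 2 / \<rho>) * exp (\<rho> / 2 * - s)))"
        using \<open>C \<ge> 0\<close> by (intro mult_left_mono lin) auto
      also have "\<dots> = C * (1 + 2 / \<rho>) * (exp (\<rho> * s) * exp (\<rho> / 2 * - s))"
        by (simp only: mult_ac)
      also have "exp (\<rho> * s) * exp (\<rho> / 2 * - s) = exp (\<rho> / 2 * s)"
        by (simp add: mult_exp_exp)
      finally show ?case .
    qed
  qed
  have "((\<lambda>s. \<sigma> * (of_real (?G s) * f' s)) has_integral P y - 0) {..<y}"
  proof (rule has_integral_FTC_Iio)
    show "(P has_vector_derivative \<sigma> * (of_real (?G s) * f' s)) (at s)" if "s < y" for s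
      using that \<open>y < 0\<close> by (intro dP) simp
    show "isCont (\<lambda>s. \<sigma> * (of_real (?G s) * f' s)) s" if "s < y" for s
      using that \<open>y < 0\<close> cont_f' by (intro continuous_intros contG) (auto simp: continuous_on_eq_continuous_at)
    show "set_integrable lborel {..<y} (\<lambda>s. \<sigma> * (of_real (?G s) * f' s))"
      using int_left by (rule set_integrable_mult_right)
    show "(P \<longlongrightarrow> 0) at_bot"
      unfolding P_def using tendsto_diff[OF tendsto_mult_right_zero[OF lim_tail, of \<sigma>] lim_e] by simp
    have "isCont P y"
      using dP[OF \<open>y < 0\<close>] by (rule has_vector_derivative_continuous)
    then show "(P \<longlongrightarrow> P y) (at_left y)"
      unfolding isCont_def by (rule tendsto_within_subset) auto
  qed
  moreover have "((\<lambda>s. \<sigma> * (of_real (?G s) * f' s)) has_integral \<sigma> * J) {..<y}"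
    using J by (rule has_integral_mult_right)
  ultimately have \<sigma>J: "\<sigma> * J = P y"
    by (metis has_integral_unique diff_zero)
  have left: "((\<lambda>s. of_real (?G (min y s)) * f' s) has_integral J) {..<y}"
    by (rule has_integral_eq[OF _ J]) auto
  have "((\<lambda>s. f' s) has_integral f 0 - f y) {y..0}"
    using \<open>y < 0\<close> f by (intro fundamental_theorem_of_calculus) (auto intro: has_vector_derivative_at_within)
  moreover have "(f' has_integral - f y) {y..0} \<longleftrightarrow> (f' has_integral - f y) {y..<0}"
    by (rule has_integral_spike_set_eq; rule negligible_subset[of "{0}"]) auto
  ultimately have "(f' has_integral - f y) {y..<0}"
    using \<open>f 0 = 0\<close> by simp
  then have "((\<lambda>s. of_real (?G y) * f' s) has_integral of_real (?G y) * - f y) {y..<0}"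
    by (rule has_integral_mult_right)
  then have right: "((\<lambda>s. of_real (?G (min y s)) * f' s) has_integral of_real (?G y) * - f y) {y..<0}"
    by (rule has_integral_eq[rotated]) auto
  have split: "{..<0} = {..<y} \<union> {y..<0}" and disj: "{..<y} \<inter> {y..<0} = {}"
    using \<open>y < 0\<close> by auto
  have total: "((\<lambda>s. of_real (?G (min y s)) * f' s) has_integral J + of_real (?G y) * - f y) {..<0}"
    unfolding split by (rule has_integral_Un[OF left right]) (simp only: disj negligible_empty)
  then show "(\<lambda>s. of_real (?G (min y s)) * f' s) integrable_on {..<0}"
    by blast
  have "\<sigma> * integral {..<0} (\<lambda>s. of_real (?G (min y s)) * f' s) = \<sigma> * (J + of_real (?G y) * - f y)"
    using total by (simp add: integral_unique)
  also have "\<dots> = P y - \<sigma> * (of_real (?G y) * f y)"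
    by (simp add: right_diff_distrib \<sigma>J)
  also have "\<dots> = - of_real (e y) * f' y"
    by (simp add: P_def)
  finally show "\<sigma> * integral {..<0} (\<lambda>s. of_real (?G (min y s)) * f' s)
      = - of_real (exp (- \<rho>\<^sup>2 / 2) * exp (\<rho> * y - y\<^sup>2 / 2)) * f' y"
    by (simp only: e_def)
qed

text \<open>Serves the square integrability of \<open>\<psi>\<close>: two powers of
  \<open>theta\<close> come from \<open>\<psi>\<close> and one from the measure. Near 0 this uses
  \<open>|y| ^ 3 \<le> y^2\<close>, beyond -1 it uses \<open>1 + |y| \<le> 2 * |y|\<close>.\<close>

lemma theta_bound:
  assumes "y < 0"
  shows "(1 + \<bar>y\<bar>)\<^sup>2 * \<bar>theta y\<bar> ^ 3 \<le> 4 * y\<^sup>2"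
proof (cases "y \<ge> -1")
  case True
  have "(1 + \<bar>y\<bar>)\<^sup>2 \<le> 2\<^sup>2" using True assms by (intro power_mono) auto
  moreover have "\<bar>y\<bar> ^ 3 \<le> \<bar>y\<bar>\<^sup>2" using True assms by (intro power_decreasing) auto
  ultimately have "(1 + \<bar>y\<bar>)\<^sup>2 * \<bar>y\<bar> ^ 3 \<le> 2\<^sup>2 * \<bar>y\<bar>\<^sup>2" by (intro mult_mono) auto
  with True show ?thesis by (simp add: theta_def)
next
  case False
  have "(1 + \<bar>y\<bar>)\<^sup>2 \<le> (2 * \<bar>y\<bar>)\<^sup>2" using False by (intro power_mono) auto
  with False show ?thesis by (simp add: theta_def power_mult_distrib)
qed

section \<open>Restriction to the imaginary axis and the equation for \<open>\<psi>\<close>\<close>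

theorem theorem5p6:
  fixes \<mu> lam \<rho> :: real and \<sigma>t \<sigma> :: complex and \<phi> :: "complex \<Rightarrow> complex"
    and \<phi>0 \<psi> :: "real \<Rightarrow> complex"
  assumes "lam \<noteq> 0" and "\<rho> = \<mu> / lam" and "\<rho> > 0"
    and "\<sigma> = \<sigma>t / of_real lam"
    and "bargmann \<phi>" and "\<phi> 0 = 0"
    and "\<And>z. H_op \<mu> lam \<phi> z = \<sigma>t * \<phi> z"
    and "\<And>y. \<phi>0 y = \<phi> (\<i> * of_real y)"
    and "\<And>y. y < 0 \<Longrightarrow> \<psi> y = vector_derivative \<phi>0 (at y) / of_real y
                              * of_real (exp (- (y^2) / 2) * theta y)"
  shows "(\<lambda>y. (cmod (\<psi> y))^2 * \<bar>theta y\<bar>) integrable_on {..<0} \<and>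
    (\<forall>y<0. (\<lambda>s. of_real (kernelN \<rho> y s) * \<psi> s) integrable_on {..<0} \<and>
           \<psi> y = - \<sigma> * of_real (exp (\<rho>^2 / 2)) * integral {..<0} (\<lambda>s. of_real (kernelN \<rho> y s) * \<psi> s))"
proof -
  have holo: "\<phi> holomorphic_on UNIV" using assms(5) by (simp add: bargmann_def)
  have holo': "deriv \<phi> holomorphic_on UNIV" using holo by (intro holomorphic_deriv) auto
  define f where "f s = \<phi> (\<i> * of_real s)" for s :: real
  define f' where "f' s = \<i> * deriv \<phi> (\<i> * of_real s)" for s :: real
  define f'' where "f'' s = - deriv (deriv \<phi>) (\<i> * of_real s)" for s :: real
  \<comment> \<open>Stated for an arbitrary entire \<open>g\<close> because it is applied to both
    \<open>\<phi>\<close> and \<open>deriv \<phi>\<close>.\<close>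
  have chain: "((\<lambda>s. g (\<i> * of_real s)) has_vector_derivative \<i> * deriv g (\<i> * of_real s)) (at s)"
    if "g holomorphic_on UNIV" for g and s :: real
  proof -
    have "((\<lambda>s. \<i> * complex_of_real s) has_vector_derivative \<i>) (at s)"
      by (auto intro!: derivative_eq_intros has_vector_derivative_of_real)
    moreover have "(g has_field_derivative deriv g (\<i> * of_real s)) (at (\<i> * of_real s))"
      using that by (simp add: holomorphic_derivI)
    ultimately show ?thesis
      using field_vector_diff_chain_at[of "\<lambda>s. \<i> * complex_of_real s" \<i> s g] by (simp add: o_def)
  qed
  have f: "(f has_vector_derivative f' s) (at s)" for s
    unfolding f_def f'_def using holo by (rule chain)
  have f': "(f' has_vector_derivative f'' s) (at s)" for s
    using has_vector_derivative_mult_right[OF chain[OF holo', of s], of \<i>]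
    unfolding f'_def f''_def by (simp flip: mult.assoc)
  have ode: "of_real s * f'' s + of_real (\<rho> * s - s\<^sup>2) * f' s = \<sigma> * f s" for s
  proof -
    \<comment> \<open>At \<open>z = \<i> * s\<close> the imaginary units of the operator, of
      \<open>z\<close> and of the chain rule combine, leaving real coefficients.\<close>
    have "\<sigma>t * f s = of_real lam * (of_real s * f'' s) + (of_real \<mu> * of_real s - of_real lam * of_real s ^ 2) * f' s"
      using assms(7)[of "\<i> * of_real s"]
      by (simp add: H_op_def f_def f'_def f''_def numeral_2_eq_2 algebra_simps)
    also have "of_real \<mu> = of_real lam * (of_real \<rho> :: complex)"
      using assms(1,2) by simp
    finally have "of_real lam * (of_real s * f'' s + of_real (\<rho> * s - s\<^sup>2) * f' s) = \<sigma>t * f s"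
      by (simp add: algebra_simps)
    also have "\<dots> = of_real lam * (\<sigma> * f s)"
      using assms(1,4) by simp
    finally show ?thesis
      using assms(1) by simp
  qed
  obtain F K where F: "integrable lborel F" "\<And>y. 0 \<le> F y" "\<And>y. F y \<le> K"
    and f_F: "\<And>y. (cmod (f y))\<^sup>2 * exp (- y\<^sup>2) \<le> F y"
    and f'_F: "\<And>y. (cmod (f' y))\<^sup>2 * exp (- y\<^sup>2) \<le> (1 + \<bar>y\<bar>)\<^sup>2 * F y"
    using bargmann_imaginary_axis_bounds[OF assms(5)] unfolding f_def f'_def by (auto simp: norm_mult)
  have K: "0 \<le> K" using F(2,3)[of 0] by linarith
  have growth: "cmod v \<le> sqrt K * (1 + \<bar>y\<bar>) * exp (y\<^sup>2 / 2)"
    if "(cmod v)\<^sup>2 * exp (- y\<^sup>2) \<le> (1 + \<bar>y\<bar>)\<^sup>2 * F y" for v :: complex and y :: real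
  proof (rule power2_le_imp_le)
    have "(cmod v)\<^sup>2 * exp (- y\<^sup>2) \<le> (1 + \<bar>y\<bar>)\<^sup>2 * K"
      using that F(3)[of y] by (intro order_trans[OF that] mult_left_mono) auto
    then have "(cmod v)\<^sup>2 \<le> (1 + \<bar>y\<bar>)\<^sup>2 * K * exp (y\<^sup>2)"
      by (simp add: exp_minus field_simps)
    also have "\<dots> = (sqrt K * (1 + \<bar>y\<bar>) * exp (y\<^sup>2 / 2))\<^sup>2"
      using K by (simp add: power_mult_distrib exp_double[symmetric])
    finally show "(cmod v)\<^sup>2 \<le> (sqrt K * (1 + \<bar>y\<bar>) * exp (y\<^sup>2 / 2))\<^sup>2" .
  qed (use K in auto)
  have f_bound: "cmod (f y) \<le> sqrt K * (1 + \<bar>y\<bar>) * exp (y\<^sup>2 / 2)" for y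
  proof (rule growth)
    \<comment> \<open>The sharper bound for \<open>f\<close> is weakened so that \<open>f\<close>
      and \<open>f'\<close> share one growth estimate.\<close>
    have "1\<^sup>2 \<le> (1 + \<bar>y\<bar>)\<^sup>2" by (intro power_mono) auto
    then have "1 * F y \<le> (1 + \<bar>y\<bar>)\<^sup>2 * F y" using F(2) by (intro mult_right_mono) auto
    with f_F[of y] show "(cmod (f y))\<^sup>2 * exp (- y\<^sup>2) \<le> (1 + \<bar>y\<bar>)\<^sup>2 * F y" by simp
  qed
  have f'_bound: "cmod (f' y) \<le> sqrt K * (1 + \<bar>y\<bar>) * exp (y\<^sup>2 / 2)" for y
    by (rule growth[OF f'_F])
  have "\<phi>0 = f" using assms(8) by (auto simp: f_def)
  then have \<psi>: "\<psi> y = f' y / of_real y * of_real (exp (- y\<^sup>2 / 2) * theta y)" if "y < 0" for y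
    using assms(9)[OF that] vector_derivative_at[OF f, of y] by simp
  have "(\<lambda>y. (cmod (\<psi> y))\<^sup>2 * \<bar>theta y\<bar>) integrable_on {..<0}"
  proof -
    \<comment> \<open>The integrand written through \<open>f'\<close>, which is measurable on the
      whole line, whereas \<open>\<psi>\<close> is prescribed only for \<open>y < 0\<close>.\<close>
    define q where "q y = (cmod (f' y))\<^sup>2 * exp (- y\<^sup>2) * \<bar>theta y\<bar> ^ 3 / y\<^sup>2" for y
    have "continuous_on UNIV f'"
      using f' by (intro continuous_at_imp_continuous_on ballI) (auto intro: has_vector_derivative_continuous)
    then have [measurable]: "f' \<in> borel_measurable borel"
      by (rule borel_measurable_continuous_onI)
    have [measurable]: "theta \<in> borel_measurable borel"
      unfolding theta_def by measurable
    have [measurable]: "q \<in> borel_measurable borel"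
      unfolding q_def by measurable
    have "q y \<le> 4 * F y" if "y < 0" for y
    proof -
      have "(cmod (f' y))\<^sup>2 * exp (- y\<^sup>2) * \<bar>theta y\<bar> ^ 3 \<le> ((1 + \<bar>y\<bar>)\<^sup>2 * F y) * \<bar>theta y\<bar> ^ 3"
        by (intro mult_right_mono f'_F) auto
      also have "\<dots> = ((1 + \<bar>y\<bar>)\<^sup>2 * \<bar>theta y\<bar> ^ 3) * F y" by simp
      also have "\<dots> \<le> 4 * y\<^sup>2 * F y"
        using theta_bound[OF that] F(2) by (intro mult_right_mono)
      finally show ?thesis
        using that unfolding q_def by (intro mult_imp_div_pos_le) (auto simp: mult_ac)
    qed
    moreover have "q y \<ge> 0" for y by (simp add: q_def)
    moreover have "set_integrable lborel {..<0} (\<lambda>y. 4 * F y)"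
      unfolding set_integrable_def using F(1) by (intro integrable_mult_indicator) auto
    ultimately have "set_integrable lborel {..<0} q"
      by (rule_tac set_integrable_bound[where f = "\<lambda>y. 4 * F y"])
        (auto simp: set_borel_measurable_def F(2) intro!: AE_I2)
    then have "q integrable_on {..<0}"
      by (rule set_borel_integral_eq_integral(1))
    moreover have "q y = (cmod (\<psi> y))\<^sup>2 * \<bar>theta y\<bar>" if "y < 0" for y
      unfolding \<psi>[OF that] q_def
      by (simp add: norm_mult norm_divide power_mult_distrib power_divide power3_eq_cube power2_eq_square mult_exp_exp mult_ac)
    ultimately show ?thesis
      by (rule_tac integrable_eq[of q]) auto
  qed
  moreover have "(\<lambda>s. of_real (kernelN \<rho> y s) * \<psi> s) integrable_on {..<0} \<and>
      \<psi> y = - \<sigma> * of_real (exp (\<rho>^2 / 2)) * integral {..<0} (\<lambda>s. of_real (kernelN \<rho> y s) * \<psi> s)"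
    if "y < 0" for y
  proof -
    \<comment> \<open>Collects the factors of the kernel depending on \<open>y\<close> alone; those
      depending on \<open>s\<close> outside the inner integral cancel against the factors in
      \<open>\<psi> s\<close>.\<close>
    define c where "c = exp (- \<rho> * y) * (theta y / y)"
    have eq: "of_real (kernelN \<rho> y s) * \<psi> s = of_real c * (of_real (kernel_tail \<rho> (min y s)) * f' s)"
      if "s < 0" for s
    proof -
      have "theta s \<noteq> 0" using that by (simp add: theta_def)
      moreover have "exp (s\<^sup>2 / 2) * exp (- s\<^sup>2 / 2) = 1" by (simp add: mult_exp_exp)
      ultimately have "kernelN \<rho> y s * (exp (- s\<^sup>2 / 2) * theta s / s) = c * kernel_tail \<rho> (min y s)"
        using that by (simp add: kernelN_def c_def kernel_tail_def kernel_weight_def[abs_def] min.commute field_simps)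
      then have "complex_of_real (kernelN \<rho> y s * (exp (- s\<^sup>2 / 2) * theta s / s)) * f' s
          = of_real (c * kernel_tail \<rho> (min y s)) * f' s"
        by (simp only:)
      then show ?thesis unfolding \<psi>[OF that] by (simp add: mult_ac)
    qed
    note tail = integral_kernel_tail_mult_deriv[where C = "sqrt K", OF assms(3) that _ _ f f' ode f_bound f'_bound]
    have f0: "f 0 = 0" using assms(6) by (simp add: f_def)
    have "(\<lambda>s. of_real c * (of_real (kernel_tail \<rho> (min y s)) * f' s)) integrable_on {..<0}"
      using tail(1) K f0 by (intro integrable_on_mult_right) auto
    then have int: "(\<lambda>s. of_real (kernelN \<rho> y s) * \<psi> s) integrable_on {..<0}"
      by (rule integrable_eq) (simp add: eq)
    have "integral {..<0} (\<lambda>s. of_real (kernelN \<rho> y s) * \<psi> s)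
        = of_real c * integral {..<0} (\<lambda>s. of_real (kernel_tail \<rho> (min y s)) * f' s)"
      unfolding integral_mult_right[symmetric] by (rule integral_cong) (simp add: eq)
    then have "- \<sigma> * of_real (exp (\<rho>^2 / 2)) * integral {..<0} (\<lambda>s. of_real (kernelN \<rho> y s) * \<psi> s)
        = - of_real (exp (\<rho>^2 / 2) * c) * (\<sigma> * integral {..<0} (\<lambda>s. of_real (kernel_tail \<rho> (min y s)) * f' s))"
      by simp
    also have "\<dots> = of_real (exp (\<rho>^2 / 2) * c * (exp (- \<rho>\<^sup>2 / 2) * exp (\<rho> * y - y\<^sup>2 / 2))) * f' y"
      using tail(2) K f0 by simp
    \<comment> \<open>The constants in \<open>\<rho>\<close> and the factors
      \<open>exp (- \<rho> * y)\<close> and \<open>exp (\<rho> * y)\<close> cancel, which leaves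
      exactly the prefactor of \<open>f' y\<close> in \<open>\<psi> y\<close>.\<close>
    also have "exp (\<rho>^2 / 2) * c * (exp (- \<rho>\<^sup>2 / 2) * exp (\<rho> * y - y\<^sup>2 / 2))
        = exp (\<rho>\<^sup>2 / 2 + - \<rho> * y + - \<rho>\<^sup>2 / 2 + (\<rho> * y - y\<^sup>2 / 2)) * (theta y / y)"
      unfolding c_def exp_add by simp
    also have "\<rho>\<^sup>2 / 2 + - \<rho> * y + - \<rho>\<^sup>2 / 2 + (\<rho> * y - y\<^sup>2 / 2) = - y\<^sup>2 / 2" by simp
    finally show ?thesis
      using int \<psi>[OF that] by simp
  qed
  ultimately show ?thesis by blast
qed

end
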